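(* Let $s\ge 1$, $r\ge 3$ and $n>r^3$ be integers, and let $G_1,G_2,\dots,G_s\subseteq\binom{[n]}{2}$ be (edge sets of) simple graphs on the vertex set $[n]$ that are $(r-1)$-star edge-colored $K_r$-free. Then $$\sum_{i=1}^{s}e(G_i)\le\begin{cases} s\binom{n}{2}, & \text{if } s\le r-2,\\ s\cdot t(n,r-1)+sn, & \text{if } s\ge r-1.\end{cases}$$
   Context: Given simple graphs $G_1,\dots,G_s$ on the same vertex set $V$, let $G=G_1+\cdots+G_s$ be the edge-colored multigraph on $V$ in which each edge of $G_i$ appears with color $i$ (so a pair $xy$ appears once in each color $i$ with $xy\in E(G_i)$). An edge-colored complete graph $K_r$ (each pair of vertices having exactly one colored edge) is called a $k$-star edge-colored $K_r$ if it uses exactly $k$ colors and, for each color used, the edges of that color form a star (all the edges of that color share a common vertex, a single edge being a star; a triangle is not a star). The family $G_1,\dots,G_s$ is $k$-star edge-colored $K_r$-free if $G=G_1+\cdots+G_s$ contains no $k$-star edge-colored $K_r$; that is, there do not exist $r$ distinct vertices together with a choice, for each pair $xy$ of them, of a color $c(xy)\in[s]$ with $xy\in E(G_{c(xy)})$, such that exactly $k$ colors are used and each color class is a star. $e(G_i)$ is the number of edges of $G_i$, and $t(n,k)$ is the number of edges of the Turán graph $T(n,k)$, the complete $k$-partite graph on $n$ vertices whose part sizes differ by at most $1$. *)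

theory Defs
  imports Complex_Main "HOL-Library.Ramsey"
begin

text \<open>A simple graph on \<open>V\<close> is given by its edge set, a subset of \<open>[V]\<^bsup>2\<^esup>\<close> (notation of
  \<^theory>\<open>HOL-Library.Ramsey\<close>: the two-element subsets of \<open>V\<close>).\<close>

definition complete_multipartite :: "nat \<Rightarrow> 'a set \<Rightarrow> ('a \<Rightarrow> nat) \<Rightarrow> 'a set set" where
  "complete_multipartite k V f = {{x, y} | x y. x \<in> V \<and> y \<in> V \<and> f x < k \<and> f y < k \<and> f x \<noteq> f y}"

definition balanced :: "nat \<Rightarrow> 'a set \<Rightarrow> ('a \<Rightarrow> nat) \<Rightarrow> bool" where
  "balanced k V f \<longleftrightarrow> f ` V \<subseteq> {..<k} \<and>
     (\<forall>i<k. \<forall>j<k. card {x \<in> V. f x = i} \<le> card {x \<in> V. f x = j} + 1)"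

text \<open>The parts of the Turan graph are taken to be the residue classes modulo \<open>k\<close>; by
  \<open>balanced_mod\<close> below their sizes differ by at most one.\<close>

definition turan_graph :: "nat \<Rightarrow> nat \<Rightarrow> nat set set" where
  "turan_graph n k = complete_multipartite k {1..n} (\<lambda>x. x mod k)"

definition turan_number :: "nat \<Rightarrow> nat \<Rightarrow> nat" where
  "turan_number n k = card (turan_graph n k)"

lemma card_mod_class:
  fixes n k i :: nat
  assumes "i < k"
  shows "card {x \<in> {1..n}. x mod k = i} + (if i = 0 then 1 else 0) = (n + k - i) div k"
proof (induction n)
  case 0
  show ?case using assms by (auto simp: div_eq_0_iff)
next
  case (Suc n)
  have mod_iff: "Suc n mod k = i \<longleftrightarrow> Suc (n + k - i) mod k = 0"
  proof -
    have "Suc n mod k = i \<longleftrightarrow> int (Suc n) mod int k = int i mod int k"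
      using assms by (metis mod_less of_nat_eq_iff of_nat_mod)
    also have "\<dots> \<longleftrightarrow> int k dvd int (Suc n) - int i"
      by (rule mod_eq_dvd_iff)
    also have "\<dots> \<longleftrightarrow> int k dvd (int (Suc n) - int i) + int k"
      by simp
    also have "(int (Suc n) - int i) + int k = int (Suc (n + k - i))"
      using assms by simp
    finally show ?thesis by (simp only: of_nat_dvd_iff flip: dvd_eq_mod_eq_0)
  qed
  have ins: "{x \<in> {1..Suc n}. x mod k = i} =
      (if Suc n mod k = i then insert (Suc n) {x \<in> {1..n}. x mod k = i}
       else {x \<in> {1..n}. x mod k = i})"
    by (auto simp: le_Suc_eq)
  have "card {x \<in> {1..Suc n}. x mod k = i} =
      card {x \<in> {1..n}. x mod k = i} + (if Suc n mod k = i then 1 else 0)"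
    unfolding ins by simp
  moreover have "(Suc n + k - i) div k = (n + k - i) div k + (if Suc n mod k = i then 1 else 0)"
    using assms mod_iff div_Suc[of "n + k - i" k] by (simp add: Suc_diff_le)
  ultimately show ?case using Suc.IH by simp
qed

lemma balanced_mod:
  assumes "k > 0"
  shows "balanced k {1..n} (\<lambda>x. x mod k)"
  unfolding balanced_def
proof (intro conjI allI impI)
  show "(\<lambda>x. x mod k) ` {1..n} \<subseteq> {..<k}" using assms by auto
  fix i j assume ij: "i < k" "j < k"
  have card_bounds: "n div k \<le> card {x \<in> {1..n}. x mod k = l} \<and>
      card {x \<in> {1..n}. x mod k = l} \<le> n div k + 1" if "l < k" for l
  proof -
    have "n div k \<le> (n + k - l) div k" using that by (intro div_le_mono) simp
    moreover have "(n + k - l) div k \<le> n div k + 1"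
      using div_le_mono[of "n + k - l" "n + k" k] assms by simp
    ultimately show ?thesis
      using card_mod_class[OF that, of n] assms by (auto split: if_splits)
  qed
  show "card {x \<in> {1..n}. x mod k = i} \<le> card {x \<in> {1..n}. x mod k = j} + 1"
    using card_bounds[OF ij(1)] card_bounds[OF ij(2)] by linarith
qed

text \<open>The colored multigraph \<open>G\<^sub>1 + \<dots> + G\<^sub>s\<close> as its set of (edge, color) pairs.\<close>

definition colored_sum :: "nat \<Rightarrow> (nat \<Rightarrow> 'a set set) \<Rightarrow> ('a set \<times> nat) set" where
  "colored_sum s G = {(e, i). i \<in> {1..s} \<and> e \<in> G i}"

definition is_star :: "'a set set \<Rightarrow> bool" where
  "is_star S \<longleftrightarrow> S \<noteq> {} \<and> (\<exists>v. \<forall>e\<in>S. v \<in> e)"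

text \<open>\<open>c\<close> colors the edges of the complete graph on the vertex set \<open>R\<close>.\<close>

definition star_colored_complete :: "nat \<Rightarrow> nat \<Rightarrow> 'a set \<Rightarrow> ('a set \<Rightarrow> nat) \<Rightarrow> bool" where
  "star_colored_complete k r R c \<longleftrightarrow>
     finite R \<and> card R = r \<and> card (c ` [R]\<^bsup>2\<^esup>) = k \<and>
     (\<forall>i \<in> c ` [R]\<^bsup>2\<^esup>. is_star {e \<in> [R]\<^bsup>2\<^esup>. c e = i})"

definition star_colored_free ::
    "nat \<Rightarrow> nat \<Rightarrow> 'a set \<Rightarrow> nat \<Rightarrow> (nat \<Rightarrow> 'a set set) \<Rightarrow> bool" where
  "star_colored_free k r V s G \<longleftrightarrow>
     \<not> (\<exists>R c. R \<subseteq> V \<and> star_colored_complete k r R c \<and>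
            (\<forall>e \<in> [R]\<^bsup>2\<^esup>. (e, c e) \<in> colored_sum s G))"

end

theory Submission
  imports Defs
begin

text \<open>Put \<open>k = r - 1\<close> and suppose \<open>s \<ge> k\<close>. Call a color missing at a pair of vertices if the pair is
  not an edge of that color, and count all \<open>s\<close> colors as missing at a pair \<open>xx\<close>. Suppose that
  every vertex of an \<open>m\<close>-vertex set has fewer than \<open>s m / k\<close> missing pairs (vertex, color).
  Averaging over the candidates then yields, one after the other, vertices
  \<open>u\<^sub>0, \<dots>, u\<^sub>k\<close> such that fewer than \<open>j s / k\<close> colors are missing in total between \<open>u\<^sub>j\<close> and its
  predecessors. Now assign colors backwards: since \<open>j s / k \<le> s - (k - j)\<close>, when it is
  the turn of \<open>u\<^sub>j\<close> some unused color joins it to all its predecessors. The resulting stars form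
  a \<open>k\<close>-star edge-colored \<open>K\<^sub>r\<close>. Hence in a free family every \<open>m\<close>-vertex set has a vertex of total
  degree at most \<open>(1 - 1/k) s m\<close>, and deleting such vertices one by one bounds the number of edges
  by \<open>(1 - 1/k) s n (n + 1) / 2\<close>, which is within \<open>s n\<close> of \<open>s\<close> times the Turan number.\<close>

section \<open>Restricting free families and extending star colorings\<close>

lemma star_colored_free_mono:
  assumes "star_colored_free k r V s G" "W \<subseteq> V" "\<And>i. i \<in> {1..s} \<Longrightarrow> H i \<subseteq> G i"
  shows "star_colored_free k r W s H"
proof -
  have "colored_sum s H \<subseteq> colored_sum s G"
    using assms(3) by (auto simp: colored_sum_def)
  then show ?thesis
    using assms(1,2) unfolding star_colored_free_def by (meson order_trans subsetD)
qed

lemma nsets_2_insert: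
  assumes "x \<notin> U"
  shows "[insert x U]\<^bsup>2\<^esup> = [U]\<^bsup>2\<^esup> \<union> (\<lambda>u. {x, u}) ` U"
  using assms by (auto simp: nsets_def card_2_iff doubleton_eq_iff)

lemma star_colored_complete_insert:
  assumes c: "star_colored_complete k r U c" and "U \<noteq> {}" "x \<notin> U"
    and i: "i \<notin> c ` [U]\<^bsup>2\<^esup>"
  shows "star_colored_complete (Suc k) (Suc r) (insert x U) (\<lambda>e. if x \<in> e then i else c e)"
    (is "star_colored_complete _ _ ?U ?c")
proof -
  have xU: "x \<notin> e" if "e \<in> [U]\<^bsup>2\<^esup>" for e
    using that \<open>x \<notin> U\<close> by (auto simp: nsets_def)
  have finU: "finite U" "card U = r" "card (c ` [U]\<^bsup>2\<^esup>) = k"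
    using c by (auto simp: star_colored_complete_def)
  note ins = nsets_2_insert[OF \<open>x \<notin> U\<close>]
  have old: "?c ` [U]\<^bsup>2\<^esup> = c ` [U]\<^bsup>2\<^esup>"
    using xU by (intro image_cong) auto
  have img: "?c ` [?U]\<^bsup>2\<^esup> = insert i (c ` [U]\<^bsup>2\<^esup>)"
    unfolding ins image_Un old using \<open>U \<noteq> {}\<close> by auto
  have "is_star {e \<in> [?U]\<^bsup>2\<^esup>. ?c e = a}" if "a \<in> insert i (c ` [U]\<^bsup>2\<^esup>)" for a
  proof (cases "a = i")
    case True
    have "x \<in> e" if "e \<in> [?U]\<^bsup>2\<^esup>" "?c e = i" for e
      using that i unfolding ins by (auto split: if_splits)
    moreover obtain u where "u \<in> U" using \<open>U \<noteq> {}\<close> by blast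
    then have "{x, u} \<in> {e \<in> [?U]\<^bsup>2\<^esup>. ?c e = i}" unfolding ins by auto
    ultimately show ?thesis unfolding is_star_def True by blast
  next
    case False
    have "{e \<in> [?U]\<^bsup>2\<^esup>. ?c e = a} = {e \<in> [U]\<^bsup>2\<^esup>. c e = a}"
      using False xU unfolding ins by auto
    then show ?thesis using that False c by (auto simp: star_colored_complete_def)
  qed
  moreover have "finite (c ` [U]\<^bsup>2\<^esup>)" using finU(1) by (simp add: finite_imp_finite_nsets)
  ultimately show ?thesis
    unfolding star_colored_complete_def img using finU i \<open>x \<notin> U\<close> by simp
qed

section \<open>Missing colors and the choice of vertices\<close>

definition missing :: "nat \<Rightarrow> (nat \<Rightarrow> 'a set set) \<Rightarrow> 'a \<Rightarrow> 'a \<Rightarrow> nat set" where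
  "missing s G x y = {i \<in> {1..s}. {x, y} \<notin> G i}"

lemma finite_missing [simp]: "finite (missing s G x y)"
  by (simp add: missing_def)

text \<open>Double counting: if every candidate \<open>x\<close> failed, summing over
  \<open>V\<close> and swapping the sums would contradict the bound on the vertices of
  \<open>U\<close>.\<close>

lemma exists_few_missing:
  assumes "finite V" "U \<subseteq> V" "U \<noteq> {}"
    and "\<And>u. u \<in> U \<Longrightarrow> k * (\<Sum>x\<in>V. card (missing s G x u)) < s * card V"
  shows "\<exists>x\<in>V. k * (\<Sum>u\<in>U. card (missing s G x u)) < card U * s"
proof (rule ccontr)
  assume "\<not> ?thesis"
  then have "(\<Sum>x\<in>V. card U * s) \<le> (\<Sum>x\<in>V. k * (\<Sum>u\<in>U. card (missing s G x u)))"
    by (intro sum_mono) auto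
  also have "\<dots> = (\<Sum>u\<in>U. k * (\<Sum>x\<in>V. card (missing s G x u)))"
    by (simp add: sum_distrib_left sum.swap[of _ V])
  also have "\<dots> < (\<Sum>u\<in>U. s * card V)"
    using assms finite_subset by (intro sum_strict_mono) auto
  finally show False by (simp add: ac_simps)
qed

text \<open>Quantifying over the set \<open>C\<close> of available colors lets the vertices be chosen forwards and
  the colors backwards in a single induction.\<close>

lemma star_colored_complete_if_few_missing:
  fixes G :: "nat \<Rightarrow> 'a set set"
  assumes "finite V" "V \<noteq> {}" "k \<le> s"
    and G: "\<And>i. i \<in> {1..s} \<Longrightarrow> G i \<subseteq> [V]\<^bsup>2\<^esup>"
    and few: "\<And>u. u \<in> V \<Longrightarrow> k * (\<Sum>x\<in>V. card (missing s G x u)) < s * card V"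
    and "j \<le> k"
  shows "\<exists>U\<subseteq>V. card U = Suc j \<and> (\<forall>C\<subseteq>{1..s}. s + j \<le> card C + k \<longrightarrow>
    (\<exists>c. star_colored_complete j (Suc j) U c \<and> (\<forall>e\<in>[U]\<^bsup>2\<^esup>. c e \<in> C \<and> e \<in> G (c e))))"
  using \<open>j \<le> k\<close>
proof (induction j)
  case 0
  obtain v where "v \<in> V" using \<open>V \<noteq> {}\<close> by blast
  have "[{v}]\<^bsup>2\<^esup> = {}" by (auto simp: nsets_def card_2_iff)
  then show ?case
    using \<open>v \<in> V\<close> by (intro exI[of _ "{v}"]) (auto simp: star_colored_complete_def)
next
  case (Suc j)
  then obtain U where U: "U \<subseteq> V" "card U = Suc j"
    and IH: "\<And>C. C \<subseteq> {1..s} \<Longrightarrow> s + j \<le> card C + k \<Longrightarrow>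
      \<exists>c. star_colored_complete j (Suc j) U c \<and> (\<forall>e\<in>[U]\<^bsup>2\<^esup>. c e \<in> C \<and> e \<in> G (c e))"
    by (metis Suc_leD)
  have "U \<noteq> {}" "finite U" using U \<open>finite V\<close> finite_subset by auto
  then obtain x where "x \<in> V" and x: "k * (\<Sum>u\<in>U. card (missing s G x u)) < Suc j * s"
    using exists_few_missing[of V U k s G] U few \<open>finite V\<close> by (metis subsetD)
  have "x \<notin> U"
  proof
    assume "x \<in> U"
    \<comment> \<open>The singleton \<open>{x, x}\<close> is an edge of no color, so a candidate
      inside \<open>U\<close> would already have \<open>s\<close> missing colors, too many as
      \<open>Suc j \<le> k\<close>.\<close>
    have "missing s G x x = {1..s}" using G by (fastforce simp: missing_def nsets_def)
    then have "s \<le> (\<Sum>u\<in>U. card (missing s G x u))"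
      using member_le_sum[OF \<open>x \<in> U\<close>, of "\<lambda>u. card (missing s G x u)"] \<open>finite U\<close> by simp
    then have "k * s < Suc j * s" using x by (meson le_less_trans mult_le_mono2)
    then show False using \<open>Suc j \<le> k\<close> by (metis mult_le_mono1 not_le)
  qed
  \<comment> \<open>Integer form of \<open>Suc j * s / k \<le> s - (k - Suc j)\<close>, which rests
    on \<open>k \<le> s\<close>. The blocked colors are thus fewer than the colors that
    \<open>C\<close> must contain.\<close>
  have M: "card (\<Union>u\<in>U. missing s G x u) + k < s + Suc j"
  proof (rule ccontr)
    assume "\<not> ?thesis"
    moreover have "card (\<Union>u\<in>U. missing s G x u) \<le> (\<Sum>u\<in>U. card (missing s G x u))"
      by (rule card_UN_le[OF \<open>finite U\<close>])
    ultimately have "s \<le> (\<Sum>u\<in>U. card (missing s G x u)) + (k - Suc j)"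
      using \<open>Suc j \<le> k\<close> by linarith
    then have "k * s \<le> k * (\<Sum>u\<in>U. card (missing s G x u)) + k * (k - Suc j)"
      by (metis distrib_left mult_le_mono2)
    also have "\<dots> < Suc j * s + s * (k - Suc j)"
      using x \<open>k \<le> s\<close> by (intro add_less_le_mono mult_le_mono1)
    also have "\<dots> = k * s" using \<open>Suc j \<le> k\<close> by (metis add_mult_distrib2 le_add_diff_inverse mult.commute)
    finally show False by simp
  qed
  show ?case
  proof (intro exI[of _ "insert x U"] conjI allI impI)
    show "insert x U \<subseteq> V" "card (insert x U) = Suc (Suc j)"
      using \<open>x \<in> V\<close> \<open>x \<notin> U\<close> \<open>finite U\<close> U by auto
    fix C assume C: "C \<subseteq> {1..s}" "s + Suc j \<le> card C + k"
    have "finite C" using C finite_subset by blast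
    have "\<not> C \<subseteq> (\<Union>u\<in>U. missing s G x u)"
      using M C(2) card_mono[of "\<Union>u\<in>U. missing s G x u" C] \<open>finite U\<close> by auto
    then obtain i where i: "i \<in> C" "\<And>u. u \<in> U \<Longrightarrow> {x, u} \<in> G i"
      using C(1) unfolding missing_def by blast
    \<comment> \<open>Reserving \<open>i\<close> costs one color, and the demand on the available
      set also drops by one from \<open>Suc j\<close> to \<open>j\<close>.\<close>
    have "s + j \<le> card (C - {i}) + k" using C(2) i(1) \<open>finite C\<close> by simp
    then obtain c where c: "star_colored_complete j (Suc j) U c"
      "\<And>e. e \<in> [U]\<^bsup>2\<^esup> \<Longrightarrow> c e \<in> C - {i} \<and> e \<in> G (c e)"
      using IH[of "C - {i}"] C(1) by blast
    let ?c = "\<lambda>e. if x \<in> e then i else c e"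
    have "star_colored_complete (Suc j) (Suc (Suc j)) (insert x U) ?c"
      using c \<open>U \<noteq> {}\<close> \<open>x \<notin> U\<close> by (intro star_colored_complete_insert) auto
    moreover have "?c e \<in> C \<and> e \<in> G (?c e)" if "e \<in> [insert x U]\<^bsup>2\<^esup>" for e
    proof (cases "x \<in> e")
      case True
      then have "e \<in> (\<lambda>u. {x, u}) ` U"
        using that \<open>x \<notin> U\<close> by (auto simp: nsets_2_insert[OF \<open>x \<notin> U\<close>]) (auto simp: nsets_def)
      then show ?thesis using i by auto
    next
      case False
      then show ?thesis using that c(2) by (auto simp: nsets_2_insert[OF \<open>x \<notin> U\<close>])
    qed
    ultimately show "\<exists>c. star_colored_complete (Suc j) (Suc (Suc j)) (insert x U) c \<and>
        (\<forall>e\<in>[insert x U]\<^bsup>2\<^esup>. c e \<in> C \<and> e \<in> G (c e))"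
      by blast
  qed
qed

section \<open>Degrees and the edge bound by vertex deletion\<close>

definition color_degree :: "(nat \<Rightarrow> 'a set set) \<Rightarrow> 'a set \<Rightarrow> 'a \<Rightarrow> nat \<Rightarrow> nat" where
  "color_degree G V v i = card {x \<in> V. {x, v} \<in> G i}"

lemma sum_card_missing:
  assumes "finite V"
  shows "(\<Sum>x\<in>V. card (missing s G x v)) + (\<Sum>i=1..s. color_degree G V v i) = s * card V"
proof -
  have "(\<Sum>x\<in>V. card (missing s G x v)) = (\<Sum>x\<in>V. \<Sum>i=1..s. if {x, v} \<notin> G i then 1 else 0)"
    by (intro sum.cong refl) (simp add: missing_def sum.If_cases Int_def)
  moreover have "(\<Sum>i=1..s. color_degree G V v i)
      = (\<Sum>x\<in>V. \<Sum>i=1..s. if {x, v} \<in> G i then 1 else 0)"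
    unfolding color_degree_def
    using assms by (subst sum.swap) (simp add: sum.If_cases Int_def)
  ultimately have "(\<Sum>x\<in>V. card (missing s G x v)) + (\<Sum>i=1..s. color_degree G V v i)
      = (\<Sum>x\<in>V. \<Sum>i=1..s. (if {x, v} \<notin> G i then 1 else 0) + (if {x, v} \<in> G i then 1 else 0))"
    by (simp add: sum.distrib)
  also have "\<dots> = (\<Sum>x\<in>V. \<Sum>i=1..s. 1)"
    by (intro sum.cong refl) auto
  finally show ?thesis by simp
qed

text \<open>Total degrees above \<open>(1 - 1/k) * s * card V\<close> at all vertices mean, by
  complementation, few missing pairs everywhere, which forces the forbidden configuration.\<close>

lemma exists_low_degree:
  fixes G :: "nat \<Rightarrow> 'a set set"
  assumes "finite V" "V \<noteq> {}" "k \<le> s"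
    and G: "\<And>i. i \<in> {1..s} \<Longrightarrow> G i \<subseteq> [V]\<^bsup>2\<^esup>"
    and free: "star_colored_free k (Suc k) V s G"
  shows "\<exists>v\<in>V. k * (\<Sum>i=1..s. color_degree G V v i) \<le> (k - 1) * (s * card V)"
proof (rule ccontr)
  assume neg: "\<not> ?thesis"
  have "k * (\<Sum>x\<in>V. card (missing s G x u)) < s * card V" if "u \<in> V" for u
  proof -
    have "k * (\<Sum>i=1..s. color_degree G V u i) > (k - 1) * (s * card V)"
      using neg that by auto
    \<comment> \<open>The strict inequality rules out \<open>k = 0\<close>, where truncated
      subtraction could break the identity.\<close>
    moreover from this have "(k - 1) * (s * card V) + s * card V = k * (s * card V)"
      by (cases k) auto
    moreover have "k * (\<Sum>x\<in>V. card (missing s G x u)) + k * (\<Sum>i=1..s. color_degree G V u i)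
        = k * (s * card V)"
      by (metis sum_card_missing[OF \<open>finite V\<close>] distrib_left)
    ultimately show ?thesis by linarith
  qed
  \<comment> \<open>With \<open>j = k\<close> all of \<open>{1..s}\<close> serves as
    \<open>C\<close>, and the size condition holds with equality.\<close>
  from star_colored_complete_if_few_missing[OF assms(1-4) this order.refl]
  obtain U c where U: "U \<subseteq> V" "star_colored_complete k (Suc k) U c"
    and "\<forall>e\<in>[U]\<^bsup>2\<^esup>. c e \<in> {1..s} \<and> e \<in> G (c e)"
    by (metis card_atLeastAtMost diff_Suc_1 order.refl)
  then have "\<forall>e\<in>[U]\<^bsup>2\<^esup>. (e, c e) \<in> colored_sum s G"
    by (simp add: colored_sum_def)
  with U show False
    using free unfolding star_colored_free_def by blast
qed

lemma card_delete_vertex: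
  assumes "finite V" "v \<in> V" "G i \<subseteq> [V]\<^bsup>2\<^esup>"
  shows "card (G i) = card (G i \<inter> [V - {v}]\<^bsup>2\<^esup>) + color_degree G V v i"
proof -
  have "[V]\<^bsup>2\<^esup> = [V - {v}]\<^bsup>2\<^esup> \<union> (\<lambda>x. {v, x}) ` (V - {v})"
    using nsets_2_insert[of v "V - {v}"] \<open>v \<in> V\<close> by (simp add: insert_absorb)
  moreover have "{v} \<notin> G i" using assms(3) by (auto simp: nsets_def)
  ultimately have "G i = (G i \<inter> [V - {v}]\<^bsup>2\<^esup>) \<union> (\<lambda>x. {x, v}) ` {x \<in> V. {x, v} \<in> G i}"
    using assms(3) by (auto simp: insert_commute)
  moreover have "card ((\<lambda>x. {x, v}) ` {x \<in> V. {x, v} \<in> G i}) = color_degree G V v i"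
    unfolding color_degree_def by (intro card_image inj_onI) (auto simp: doubleton_eq_iff)
  moreover have "(G i \<inter> [V - {v}]\<^bsup>2\<^esup>) \<inter> (\<lambda>x. {x, v}) ` {x \<in> V. {x, v} \<in> G i} = {}"
    by (auto simp: nsets_def)
  moreover have "finite (G i \<inter> [V - {v}]\<^bsup>2\<^esup>)"
    using assms(1) by (simp add: finite_imp_finite_nsets)
  ultimately show ?thesis
    using \<open>finite V\<close> card_Un_disjoint[of "G i \<inter> [V - {v}]\<^bsup>2\<^esup>" "(\<lambda>x. {x, v}) ` {x \<in> V. {x, v} \<in> G i}"]
    by simp
qed

text \<open>Freeness survives deleting a low-degree vertex, and the degree bounds
  \<open>(1 - 1/k) * s * m\<close> for \<open>m = 1, ..., card V\<close> add up to the right-hand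
  side.\<close>

lemma sum_card_le_if_free:
  fixes G :: "nat \<Rightarrow> 'a set set"
  assumes "finite V" "k \<le> s"
    and "\<And>i. i \<in> {1..s} \<Longrightarrow> G i \<subseteq> [V]\<^bsup>2\<^esup>"
    and "star_colored_free k (Suc k) V s G"
  shows "2 * k * (\<Sum>i=1..s. card (G i)) \<le> (k - 1) * s * (card V * Suc (card V))"
  using assms
proof (induction "card V" arbitrary: V G)
  case 0
  then have "G i = {}" if "i \<in> {1..s}" for i
    using that by (fastforce simp: nsets_def)
  then show ?case by simp
next
  case (Suc m)
  then have "V \<noteq> {}" by auto
  with Suc.prems obtain v where v: "v \<in> V"
    "k * (\<Sum>i=1..s. color_degree G V v i) \<le> (k - 1) * (s * card V)"
    using exists_low_degree[of V k s G] by blast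
  let ?W = "V - {v}"
  let ?H = "\<lambda>i. G i \<inter> [?W]\<^bsup>2\<^esup>"
  have cW: "m = card ?W" using Suc.hyps(2) v(1) Suc.prems(1) by simp
  have "star_colored_free k (Suc k) ?W s ?H"
    by (rule star_colored_free_mono[OF Suc.prems(4)]) auto
  then have IH: "2 * k * (\<Sum>i=1..s. card (?H i)) \<le> (k - 1) * s * (m * Suc m)"
    using Suc.hyps(1)[OF cW, of ?H] Suc.prems(1,2) cW by simp
  have "(\<Sum>i=1..s. card (G i)) = (\<Sum>i=1..s. card (?H i)) + (\<Sum>i=1..s. color_degree G V v i)"
    unfolding sum.distrib[symmetric]
    using card_delete_vertex[OF Suc.prems(1) v(1)] Suc.prems(3) by (intro sum.cong refl) auto
  then have "2 * k * (\<Sum>i=1..s. card (G i))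
      = 2 * k * (\<Sum>i=1..s. card (?H i)) + 2 * (k * (\<Sum>i=1..s. color_degree G V v i))"
    by (simp add: algebra_simps)
  also have "\<dots> \<le> (k - 1) * s * (m * Suc m) + 2 * ((k - 1) * (s * Suc m))"
    using IH v(2) Suc.hyps(2) by (intro add_mono mult_le_mono2) auto
  also have "\<dots> = (k - 1) * s * (Suc m * Suc (Suc m))"
    by (simp add: algebra_simps)
  finally show ?case using Suc.hyps(2) by simp
qed

section \<open>Lower bound for the Turan number\<close>

text \<open>The new vertex \<open>Suc n\<close> is joined to every earlier vertex outside its
  residue class, and that class has at most \<open>n div k\<close> earlier members.\<close>

lemma turan_number_Suc_ge:
  assumes "k > 0"
  shows "turan_number n k + n \<le> turan_number (Suc n) k + n div k"
proof -
  let ?A = "{x \<in> {1..n}. x mod k = Suc n mod k}"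
  let ?B = "{x \<in> {1..n}. x mod k \<noteq> Suc n mod k}"
  let ?E = "(\<lambda>x. {x, Suc n}) ` ?B"
  have fin: "finite (turan_graph m k)" for m
  proof (rule finite_subset)
    show "turan_graph m k \<subseteq> Pow {1..m}"
      by (auto simp: turan_graph_def complete_multipartite_def)
  qed simp
  have "turan_graph n k \<union> ?E \<subseteq> turan_graph (Suc n) k"
    using assms unfolding turan_graph_def complete_multipartite_def by fastforce
  moreover have "turan_graph n k \<inter> ?E = {}"
    by (auto simp: turan_graph_def complete_multipartite_def doubleton_eq_iff)
  moreover have "card ?E = card ?B"
    by (intro card_image inj_onI) (auto simp: doubleton_eq_iff)
  ultimately have 1: "turan_number n k + card ?B \<le> turan_number (Suc n) k"
    unfolding turan_number_def
    using card_mono[OF fin, of "turan_graph n k \<union> ?E"] card_Un_disjoint[OF fin, of ?E n] by simp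
  have "card ?A + card ?B = card (?A \<union> ?B)"
    by (intro card_Un_disjoint[symmetric]) auto
  also have "?A \<union> ?B = {1..n}" by auto
  finally have 2: "card ?A + card ?B = n" by simp
  \<comment> \<open>An earlier member lies below \<open>Suc n\<close> by a positive multiple
    \<open>k * j \<le> n\<close>.\<close>
  have "?A \<subseteq> (\<lambda>j. Suc n - k * j) ` {1..n div k}"
  proof
    fix x assume x: "x \<in> ?A"
    then have "x \<le> Suc n" "Suc n mod k = x mod k" by auto
    then have "k dvd Suc n - x" by (metis mod_eq_dvd_iff_nat)
    then obtain j where j: "Suc n - x = k * j" by (auto simp: dvd_def)
    have "k * j \<le> n" "j \<noteq> 0" using j x by (auto intro: Nat.gr0I)
    then have "j \<in> {1..n div k}" using assms by (simp add: less_eq_div_iff_mult_less_eq mult.commute)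
    moreover have "x = Suc n - k * j" using j x by auto
    ultimately show "x \<in> (\<lambda>j. Suc n - k * j) ` {1..n div k}" by blast
  qed
  then have "card ?A \<le> card ((\<lambda>j. Suc n - k * j) ` {1..n div k})"
    by (intro card_mono) auto
  also have "\<dots> \<le> n div k"
    by (rule order_trans[OF card_image_le]) auto
  finally show ?thesis using 1 2 by linarith
qed

lemma turan_number_ge:
  assumes "k > 0"
  shows "(k - 1) * (n * (n - 1)) \<le> 2 * k * turan_number n k"
proof (induction n)
  case (Suc n)
  have "k * turan_number n k + k * n \<le> k * turan_number (Suc n) k + k * (n div k)"
    by (metis turan_number_Suc_ge[OF assms] distrib_left mult_le_mono2)
  moreover have "k * (n div k) \<le> n" by simp
  moreover have "k * n = (k - 1) * n + n" using assms by (cases k) auto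
  ultimately have "k * turan_number n k + (k - 1) * n \<le> k * turan_number (Suc n) k" by linarith
  moreover have "(k - 1) * (Suc n * (Suc n - 1)) = (k - 1) * (n * (n - 1)) + 2 * ((k - 1) * n)"
    by (cases n; cases k) (simp_all add: algebra_simps)
  ultimately show ?case using Suc.IH by linarith
qed simp

theorem theorem1p5:
  fixes s r n :: nat and G :: "nat \<Rightarrow> nat set set"
  assumes "s \<ge> 1" and "r \<ge> 3" and "n > r ^ 3"
    and "\<And>i. i \<in> {1..s} \<Longrightarrow> G i \<subseteq> [{1..n}]\<^bsup>2\<^esup>"
    and "star_colored_free (r - 1) r {1..n} s G"
  shows "(\<Sum>i=1..s. card (G i)) \<le>
           (if s \<le> r - 2 then s * (n choose 2)
            else s * turan_number n (r - 1) + s * n)"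
proof (cases "s \<le> r - 2")
  case True
  have "(\<Sum>i=1..s. card (G i)) \<le> (\<Sum>i=1..s. n choose 2)"
  proof (rule sum_mono)
    fix i assume "i \<in> {1..s}"
    then have "card (G i) \<le> card ([{1..n}]\<^bsup>2\<^esup>)"
      using assms(4) by (intro card_mono finite_imp_finite_nsets) auto
    then show "card (G i) \<le> n choose 2" by (simp add: card_nsets)
  qed
  then show ?thesis using True by simp
next
  case False
  define k where "k = r - 1"
  have k: "k > 0" "k \<le> s" "r = Suc k" using False assms(2) by (auto simp: k_def)
  have "2 * k * (\<Sum>i=1..s. card (G i)) \<le> (k - 1) * s * (n * Suc n)"
    using sum_card_le_if_free[of "{1..n}" k s G] assms(4,5) k by simp
  \<comment> \<open>Writing \<open>n * Suc n\<close> as \<open>n * (n - 1) + 2 * n\<close> separates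
    the Turan term from an error that, after division by \<open>2 * k\<close>, is at most
    \<open>s * n\<close>.\<close>
  also have "\<dots> = s * ((k - 1) * (n * (n - 1)) + 2 * ((k - 1) * n))"
    by (cases n; cases k) (simp_all add: algebra_simps)
  also have "\<dots> \<le> s * (2 * k * turan_number n k + 2 * (k * n))"
    using turan_number_ge[OF k(1), of n] by (intro mult_le_mono2 add_mono mult_le_mono1) auto
  also have "\<dots> = 2 * k * (s * turan_number n k + s * n)"
    by (simp add: algebra_simps)
  finally have "(\<Sum>i=1..s. card (G i)) \<le> s * turan_number n k + s * n"
    using k(1) by simp
  then show ?thesis using False by (simp add: k_def)
qed

end
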